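(* For every forest $F$ with at least one vertex, every graph $G$ and every $S\subseteq V(G)$: if $G$ has no $S$-rooted model of $F$, then $\operatorname{pw}(G,S)\leq 2|V(F)|-2$.
   Context: A model of $H$ in $G$ is a family $(B_x\mid x\in V(H))$ of pairwise disjoint subsets of $V(G)$ such that each $G[B_x]$ is non-empty and connected and for every edge $xy\in E(H)$ there is an edge of $G$ between $B_x$ and $B_y$; it is $S$-rooted if $B_x\cap S\neq\emptyset$ for all $x$. A path decomposition of a graph $H$ is a sequence of bags $(W_1,\dots,W_m)$, $m\ge1$, of subsets of $V(H)$ such that every edge of $H$ lies in some bag and for every vertex $v$ the set $\{i:v\in W_i\}$ is a non-empty interval; its width is $\max_i|W_i|-1$. A path decomposition of $(G,S)$ is a path decomposition $\mathcal B$ of some induced subgraph $H$ of $G$ with $S\subseteq V(H)$ such that for every component $C$ of $G-V(H)$ some bag of $\mathcal B$ contains all neighbours of $V(C)$ in $G$. $\operatorname{pw}(G,S)$ is the minimum width of a path decomposition of $(G,S)$. *)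

theory Defs
  imports "Graph_Theory.Digraph_Component" "HOL-Library.Disjoint_Sets"
begin

text \<open>
  A finite simple graph is rendered by the locale \<^locale>\<open>graph\<close> of the entry
  Graph Theory: a finite symmetric digraph without loops and parallel arcs, so that an edge is a
  pair of opposite arcs and adjacency is the relation \<^const>\<open>dominates\<close>.  The library notion
  \<^const>\<open>connected\<close> already excludes the graph without vertices.
\<close>

text \<open>
  The library constant \<^const>\<open>forest\<close> also forbids the closed walks of length two running along an
  arc and back along its reverse, so no symmetric digraph with an arc satisfies it.  Among graphs,
  the cycles with at least three arcs are exactly the usual undirected cycles.
\<close>
definition undirected_forest :: "('a, 'b) pre_digraph \<Rightarrow> bool" where
  "undirected_forest G \<longleftrightarrow> graph G \<and> \<not> (\<exists>p. pre_digraph.cycle G p \<and> 3 \<le> length p)"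

definition model ::
    "('h, 'e) pre_digraph \<Rightarrow> ('a, 'b) pre_digraph \<Rightarrow> ('h \<Rightarrow> 'a set) \<Rightarrow> bool" where
  "model H G B \<longleftrightarrow>
     disjoint_family_on B (verts H) \<and>
     (\<forall>x \<in> verts H. B x \<subseteq> verts G \<and> B x \<noteq> {} \<and> connected (G \<restriction> B x)) \<and>
     (\<forall>x y. x \<rightarrow>\<^bsub>H\<^esub> y \<longrightarrow> (\<exists>u \<in> B x. \<exists>v \<in> B y. u \<rightarrow>\<^bsub>G\<^esub> v))"

definition rooted_model ::
    "'a set \<Rightarrow> ('h, 'e) pre_digraph \<Rightarrow> ('a, 'b) pre_digraph \<Rightarrow> ('h \<Rightarrow> 'a set) \<Rightarrow> bool" where
  "rooted_model S H G B \<longleftrightarrow> model H G B \<and> (\<forall>x \<in> verts H. B x \<inter> S \<noteq> {})"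

definition path_decomposition :: "('a, 'b) pre_digraph \<Rightarrow> 'a set list \<Rightarrow> bool" where
  "path_decomposition H Ws \<longleftrightarrow>
     Ws \<noteq> [] \<and>
     (\<forall>W \<in> set Ws. W \<subseteq> verts H) \<and>
     (\<forall>u v. u \<rightarrow>\<^bsub>H\<^esub> v \<longrightarrow> (\<exists>W \<in> set Ws. u \<in> W \<and> v \<in> W)) \<and>
     (\<forall>v \<in> verts H. \<exists>i j. i \<le> j \<and> {k. k < length Ws \<and> v \<in> Ws ! k} = {i..j})"

text \<open>The width is an integer: it is \<open>-1\<close> if all bags are empty.\<close>
definition width :: "'a set list \<Rightarrow> int" where
  "width Ws = int (Max (card ` set Ws)) - 1"

definition component :: "('a, 'b) pre_digraph \<Rightarrow> ('a, 'b) pre_digraph \<Rightarrow> bool" where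
  "component G C \<longleftrightarrow> pre_digraph.max_subgraph G connected C"

definition neighbours :: "('a, 'b) pre_digraph \<Rightarrow> 'a set \<Rightarrow> 'a set" where
  "neighbours G A = {v. v \<notin> A \<and> (\<exists>u \<in> A. u \<rightarrow>\<^bsub>G\<^esub> v)}"

definition rooted_path_decomposition ::
    "('a, 'b) pre_digraph \<Rightarrow> 'a set \<Rightarrow> 'a set list \<Rightarrow> bool" where
  "rooted_path_decomposition G S Ws \<longleftrightarrow>
     (\<exists>H. induced_subgraph H G \<and> S \<subseteq> verts H \<and> path_decomposition H Ws \<and>
        (\<forall>C. component (G \<restriction> (verts G - verts H)) C \<longrightarrow>
           (\<exists>W \<in> set Ws. neighbours G (verts C) \<subseteq> W)))"

definition pw :: "('a, 'b) pre_digraph \<Rightarrow> 'a set \<Rightarrow> int" where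
  "pw G S = (LEAST w. \<exists>Ws. rooted_path_decomposition G S Ws \<and> width Ws = w)"

text \<open>The minimum in the definition of \<^const>\<open>pw\<close> exists.\<close>

lemma rooted_path_decomposition_trivial:
  assumes "graph G" "S \<subseteq> verts G"
  shows "rooted_path_decomposition G S [verts G]"
proof -
  interpret graph G by fact
  have ends: "u \<in> verts G \<and> v \<in> verts G" if "u \<rightarrow>\<^bsub>G\<^esub> v" for u v
    using that by (auto simp: arcs_ends_def arc_to_ends_def)
  have pd: "path_decomposition G [verts G]"
    unfolding path_decomposition_def using ends by (auto intro!: exI[of _ 0])
  have "\<not> component (G \<restriction> (verts G - verts G)) C" for C
    by (auto simp: component_def pre_digraph.max_subgraph_def connected_def
        strongly_connected_def mk_symmetric_def subgraph_def)
  with pd show ?thesis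
    unfolding rooted_path_decomposition_def using assms(2) induced_subgraph_refl by blast
qed

lemma pw_minimum:
  assumes "graph G" "S \<subseteq> verts G"
  obtains Ws where "rooted_path_decomposition G S Ws" "width Ws = pw G S"
    and "\<And>Ws'. rooted_path_decomposition G S Ws' \<Longrightarrow> pw G S \<le> width Ws'"
proof -
  obtain Ws where Ws: "rooted_path_decomposition G S Ws"
    and least: "\<And>Ws'. rooted_path_decomposition G S Ws' \<Longrightarrow>
        Max (card ` set Ws) \<le> Max (card ` set Ws')"
    using ex_has_least_nat[of "rooted_path_decomposition G S" _ "\<lambda>Ws. Max (card ` set Ws)"]
      rooted_path_decomposition_trivial[OF assms] by blast
  then have le: "width Ws \<le> width Ws'" if "rooted_path_decomposition G S Ws'" for Ws'
    using least[OF that] by (simp add: width_def)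
  have "pw G S = width Ws"
    unfolding pw_def by (rule Least_equality) (use Ws le in auto)
  then show thesis using that Ws le by metis
qed

end

theory Submission
  imports Defs
begin

text \<open>
  The proof follows Diestel's short proof of the path width theorem, but roots the branch sets only in
  the last step. Let \<open>n\<close> be the number of vertices of \<open>F\<close>, and sweep \<open>G\<close> by growing vertex sets
  \<open>X\<close> with boundary of size less than \<open>n\<close>, where the new boundary and the newly swept roots
  together number at most \<open>n\<close>; a complete sweep is a rooted path decomposition with bags of size at
  most \<open>2n - 1\<close>. If the sweep cannot be completed, add the vertices of \<open>F\<close> one by one, each with at
  most one neighbour among the earlier ones: take \<open>X\<close> maximal among the reachable sets with boundary of
  size at most \<open>m\<close>, together with an unrooted model of the first \<open>m\<close> vertices whose branch sets each
  meet the boundary of \<open>X\<close>. A vertex outside \<open>X\<close> next to the appropriate branch set is the new branch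
  set, and by Menger's theorem, submodularity of the boundary and maximality of \<open>X\<close>, the branch sets
  extend disjointly to the boundary of the next maximal set. When all \<open>n\<close> vertices are placed, either
  \<open>n\<close> disjoint paths lead on to \<open>S\<close>, which gives a rooted model, or a separator of size less than
  \<open>n\<close> lets the sweep swallow everything in front of it, since all roots swallowed lie on the separator.
\<close>

section \<open>Menger's theorem for connected sets\<close>

text \<open>\<open>rtrancl_on C\<close> confines walks to \<open>C\<close>. Working with a bare
  relation lets the proof of Menger's theorem delete edges and pass to one side without building
  digraphs.\<close>

definition conn :: "'a rel \<Rightarrow> 'a set \<Rightarrow> bool" where
  "conn r C \<longleftrightarrow> C \<noteq> {} \<and> (\<forall>u\<in>C. \<forall>v\<in>C. (u, v) \<in> rtrancl_on C r)"

lemma conn_mono: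
  assumes "conn r C" "r \<subseteq> r'"
  shows "conn r' C"
  using assms(1) rtrancl_on_mono[OF assms(2) order_refl] by (simp add: conn_def)

lemma conn_singleton: "conn r {a}"
  by (auto simp: conn_def)

lemma conn_Un:
  assumes "conn r A" "conn r B" "a \<in> A" "b \<in> B"
    and "(a, b) \<in> rtrancl_on (A \<union> B) r" "(b, a) \<in> rtrancl_on (A \<union> B) r"
  shows "conn r (A \<union> B)"
proof -
  have A: "(u, v) \<in> rtrancl_on (A \<union> B) r" if "u \<in> A" "v \<in> A" for u v
    using assms(1) that unfolding conn_def by (meson order_refl rtrancl_on_mono Un_upper1)
  have B: "(u, v) \<in> rtrancl_on (A \<union> B) r" if "u \<in> B" "v \<in> B" for u v
    using assms(2) that unfolding conn_def by (meson order_refl rtrancl_on_mono Un_upper2)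
  have "(u, a) \<in> rtrancl_on (A \<union> B) r" "(a, u) \<in> rtrancl_on (A \<union> B) r" if "u \<in> A \<union> B" for u
    using that A[OF _ assms(3)] A[OF assms(3)] B[OF _ assms(4)] B[OF assms(4)] assms(5,6)
    by (meson UnE rtrancl_on_trans)+
  then show ?thesis
    using assms(3) unfolding conn_def by (blast intro: rtrancl_on_trans)
qed

lemma conn_Un_meet:
  assumes "conn r A" "conn r B" "z \<in> A" "z \<in> B"
  shows "conn r (A \<union> B)"
  using assms by (intro conn_Un[of r A B z z]) auto

lemma conn_Un_edge:
  assumes "conn r A" "conn r B" "a \<in> A" "b \<in> B" "(a, b) \<in> r" "(b, a) \<in> r"
  shows "conn r (A \<union> B)"
  using assms by (intro conn_Un[of r A B a b]) (auto intro: rtrancl_on_into_rtrancl_on)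

section \<open>Separations and linkages\<close>

definition separation :: "'a rel \<Rightarrow> 'a set \<Rightarrow> 'a set \<Rightarrow> 'a set \<Rightarrow> bool" where
  "separation r V X Y \<longleftrightarrow> X \<union> Y = V \<and> r \<inter> (X - Y) \<times> (Y - X) = {}"

text \<open>Connected sets stand in for disjoint paths from \<open>A\<close> to \<open>B\<close>:
  they are glued by mere union, with no trimming or ordering of vertices.\<close>

definition linkage ::
    "'a rel \<Rightarrow> 'a set \<Rightarrow> 'a set \<Rightarrow> 'a set \<Rightarrow> 'i set \<Rightarrow> ('i \<Rightarrow> 'a set) \<Rightarrow> bool" where
  "linkage r V A B I C \<longleftrightarrow> disjoint_family_on C I \<and>
     (\<forall>i\<in>I. conn r (C i) \<and> C i \<subseteq> V \<and> C i \<inter> A \<noteq> {} \<and> C i \<inter> B \<noteq> {})"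

text \<open>Choosing one point of \<open>P\<close> from each member gives an injection from
  \<open>I\<close> into \<open>P\<close>, which is onto by counting. So every member owns exactly
  one point of \<open>P\<close>, and the family can be renamed by these points.\<close>

lemma disjoint_family_transversal:
  assumes "disjoint_family_on C I" "finite P" "card P \<le> card I" "finite I"
    and "\<And>i. i \<in> I \<Longrightarrow> C i \<inter> P \<noteq> {}"
  obtains g where "bij_betw g P I" "\<And>p. p \<in> P \<Longrightarrow> C (g p) \<inter> P = {p}"
proof -
  have "\<forall>i\<in>I. \<exists>p. p \<in> C i \<inter> P" using assms(5) by blast
  then obtain f where f: "\<And>i. i \<in> I \<Longrightarrow> f i \<in> C i \<inter> P"
    by (metis (full_types))
  have inj: "inj_on f I"
    using assms(1) f unfolding inj_on_def disjoint_family_on_def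
    by (metis IntD1 IntI empty_iff)
  have "f ` I = P"
    using f assms(2,3) card_image[OF inj] by (intro card_seteq) auto
  then have bij: "bij_betw f I P"
    using inj by (simp add: bij_betw_def)
  let ?g = "inv_into I f"
  have g: "bij_betw ?g P I" by (rule bij_betw_inv_into[OF bij])
  have fg: "f (?g p) = p" "?g p \<in> I" if "p \<in> P" for p
    using that bij by (auto simp: bij_betw_inv_into_right inv_into_into bij_betw_def)
  have mem: "p \<in> C (?g p)" if "p \<in> P" for p using f fg that by (metis IntD1)
  have "C (?g p) \<inter> P = {p}" if p: "p \<in> P" for p
  proof -
    have "q = p" if "q \<in> C (?g p)" "q \<in> P" for q
      using mem[OF that(2)] that fg p assms(1)
      unfolding disjoint_family_on_def by (metis IntI empty_iff)
    then show ?thesis using mem p by auto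
  qed
  with g show thesis using that by blast
qed

lemma linkage_mono:
  assumes "linkage r V A B I C" "r \<subseteq> r'"
  shows "linkage r' V A B I C"
  using assms(1) conn_mono[OF _ assms(2)] by (simp add: linkage_def)

lemma linkage_reindex:
  assumes "linkage r V A B I C" "bij_betw g P I"
  shows "linkage r V A B P (C \<circ> g)"
  using assms unfolding linkage_def disjoint_family_on_def bij_betw_def inj_on_def
  by simp (metis imageI)

text \<open>The induction is Goering's: a separation of order less than \<open>k\<close> that appears when an edge
  is deleted is crossed by this edge only, and both sides together with the end of the edge inherit
  the hypothesis.\<close>

theorem menger:
  fixes r :: "'a rel"
  assumes "finite V" "sym r" "A \<subseteq> V" "B \<subseteq> V"
    and "\<And>X Y. separation r V X Y \<Longrightarrow> A \<subseteq> X \<Longrightarrow> B \<subseteq> Y \<Longrightarrow> k \<le> card (X \<inter> Y)"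
  shows "\<exists>(I :: 'a set) C. finite I \<and> card I = k \<and> linkage r V A B I C"
  using assms
proof (induction "card (r \<inter> V \<times> V)" arbitrary: r V A B rule: less_induct)
  case less
  have fin: "finite (r \<inter> V \<times> V)" using less.prems(1) by simp
  show ?case
  proof (cases "r \<inter> V \<times> V \<subseteq> Id")
    case True
    \<comment> \<open>With no edge between distinct vertices this is a separation of order
      \<open>card (A \<inter> B)\<close>, so enough singletons are available.\<close>
    have "separation r V A (V - A \<union> B)"
      using True less.prems(3,4) unfolding separation_def by blast
    moreover have "A \<inter> (V - A \<union> B) = A \<inter> B" by auto
    ultimately have "k \<le> card (A \<inter> B)"
      using less.prems(5)[of A "V - A \<union> B"] by auto
    then obtain I where "I \<subseteq> A \<inter> B" "card I = k" "finite I"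
      by (meson obtain_subset_with_card_n)
    then have "linkage r V A B I (\<lambda>a. {a})"
      using less.prems(3) by (auto simp: linkage_def disjoint_family_on_def conn_singleton)
    with \<open>card I = k\<close> \<open>finite I\<close> show ?thesis
      by (intro exI[of _ I] exI[of _ "\<lambda>a. {a}"] conjI)
  next
    case False
    then obtain x y where xy: "(x, y) \<in> r" "x \<in> V" "y \<in> V" "x \<noteq> y" by blast
    define r' where "r' = r - {(x, y), (y, x)}"
    have "sym r'" using less.prems(2) by (auto simp: r'_def sym_def)
    have "r' \<subseteq> r" by (auto simp: r'_def)
    have less': "card (r' \<inter> V \<times> V) < card (r \<inter> V \<times> V)"
      using xy fin by (intro psubset_card_mono) (auto simp: r'_def)
    show ?thesis
    proof (cases "\<forall>X Y. separation r' V X Y \<longrightarrow> A \<subseteq> X \<longrightarrow> B \<subseteq> Y \<longrightarrow> k \<le> card (X \<inter> Y)")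
      case True
      then obtain I :: "'a set" and C where I: "finite I" "card I = k" "linkage r' V A B I C"
        using less.hyps[OF less' less.prems(1) \<open>sym r'\<close> less.prems(3,4)] by blast
      from I(3) \<open>r' \<subseteq> r\<close> have "linkage r V A B I C" by (rule linkage_mono)
      with I(1,2) show ?thesis by blast
    next
      case False
      then obtain X Y where XY: "separation r' V X Y" "A \<subseteq> X" "B \<subseteq> Y" "card (X \<inter> Y) < k"
        by (auto simp: not_le)
      \<comment> \<open>Restoring the deleted edge must destroy this separation, so that edge is the
        only one crossing from \<open>X - Y\<close> to \<open>Y - X\<close>.\<close>
      have "\<not> separation r V X Y" using less.prems(5) XY(2-4) by fastforce
      then obtain u v where uv: "(u, v) \<in> r" "u \<in> X - Y" "v \<in> Y - X"
        using XY(1) unfolding separation_def by auto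
      have only: "a = u \<and> b = v" if "(a, b) \<in> r" "a \<in> X - Y" "b \<in> Y - X" for a b
        using XY(1) that uv unfolding separation_def r'_def by blast
      have V: "X \<union> Y = V" using XY(1) by (simp add: separation_def)
      define Z where "Z = X \<inter> Y"
      have finXY: "finite X" "finite Y" "finite Z" using V less.prems(1) by (auto simp: Z_def)
      have vu: "(v, u) \<in> r" using uv less.prems(2) by (auto dest: symD)
      have cards: "card (insert u Z) \<le> k" "card (insert v Z) \<le> k"
        using XY(4) finXY uv by (auto simp: Z_def card_insert_if)
      have "k \<le> card (X' \<inter> Y')"
        if s: "separation r X X' Y'" "A \<subseteq> X'" "insert u Z \<subseteq> Y'" for X' Y'
      proof -
        \<comment> \<open>Adding all of \<open>Y\<close> to the second side keeps the order: the
          only edge from \<open>X - Y\<close> to \<open>Y - X\<close> starts at \<open>u\<close>,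
          which already lies in \<open>Y'\<close>.\<close>
        have "separation r V X' (Y' \<union> Y)"
          using s(1,3) V only unfolding separation_def Z_def by blast
        moreover have "X' \<inter> (Y' \<union> Y) = X' \<inter> Y'"
          using s(1,3) unfolding separation_def Z_def by blast
        ultimately show ?thesis using less.prems(5)[of X' "Y' \<union> Y"] s(2) XY(3) by auto
      qed
      moreover have "card (r \<inter> X \<times> X) < card (r \<inter> V \<times> V)"
        using uv V fin by (intro psubset_card_mono) auto
      ultimately obtain I1 :: "'a set" and C1
        where I1: "finite I1" "card I1 = k" "linkage r X A (insert u Z) I1 C1"
        using less.hyps[of r X A "insert u Z"] finXY less.prems(2) XY(2) uv
        by (auto simp: Z_def)
      have "k \<le> card (X' \<inter> Y')"
        if s: "separation r Y X' Y'" "insert v Z \<subseteq> X'" "B \<subseteq> Y'" for X' Y'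
      proof -
        have "separation r V (X \<union> X') Y'"
          using s(1,2) V only unfolding separation_def Z_def by blast
        moreover have "(X \<union> X') \<inter> Y' = X' \<inter> Y'"
          using s(1,2) unfolding separation_def Z_def by blast
        ultimately show ?thesis using less.prems(5)[of "X \<union> X'" Y'] s(3) XY(2) by auto
      qed
      moreover have "card (r \<inter> Y \<times> Y) < card (r \<inter> V \<times> V)"
        using uv V fin by (intro psubset_card_mono) auto
      ultimately obtain I2 :: "'a set" and C2
        where I2: "finite I2" "card I2 = k" "linkage r Y (insert v Z) B I2 C2"
        using less.hyps[of r Y "insert v Z" B] finXY less.prems(2) XY(3) uv
        by (auto simp: Z_def)
      obtain g1 where g1: "bij_betw g1 (insert u Z) I1"
        "\<And>p. p \<in> insert u Z \<Longrightarrow> C1 (g1 p) \<inter> insert u Z = {p}"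
        using disjoint_family_transversal[of C1 I1 "insert u Z"] I1 cards finXY
        unfolding linkage_def by auto
      obtain g2 where g2: "bij_betw g2 (insert v Z) I2"
        "\<And>p. p \<in> insert v Z \<Longrightarrow> C2 (g2 p) \<inter> insert v Z = {p}"
        using disjoint_family_transversal[of C2 I2 "insert v Z"] I2 cards finXY
        unfolding linkage_def by auto
      define D1 where "D1 = C1 \<circ> g1"
      \<comment> \<open>The left family ends in \<open>insert u Z\<close>, the right one starts in
        \<open>insert v Z\<close>; \<open>h\<close> exchanges \<open>u\<close> for \<open>v\<close>
        so that \<open>insert u Z\<close> indexes both.\<close>
      define h where "h = (\<lambda>p. if p = u then v else p)"
      define D2 where "D2 = C2 \<circ> g2 \<circ> h"
      have h: "bij_betw h (insert u Z) (insert v Z)"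
        using uv by (auto simp: h_def Z_def bij_betw_def inj_on_def)
      have L1: "linkage r X A (insert u Z) (insert u Z) D1"
        unfolding D1_def by (rule linkage_reindex[OF I1(3) g1(1)])
      have L2: "linkage r Y (insert v Z) B (insert u Z) D2"
        unfolding D2_def by (intro linkage_reindex[OF _ h] linkage_reindex[OF I2(3) g2(1)])
      have m1: "D1 p \<inter> insert u Z = {p}" if "p \<in> insert u Z" for p
        using g1(2)[OF that] by (simp add: D1_def)
      have m2: "D2 p \<inter> insert v Z = {h p}" if "p \<in> insert u Z" for p
        using g2(2)[of "h p"] h that by (auto simp: D2_def bij_betw_def)
      have card: "card (insert u Z) = k"
        using bij_betw_same_card[OF g1(1)] I1(2) by simp
      \<comment> \<open>A common point of a left and a right member lies in \<open>Z\<close>, so it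
        is the index of both.\<close>
      have cross: "D1 p \<inter> D2 q = {}" if "p \<in> insert u Z" "q \<in> insert u Z" "p \<noteq> q" for p q
      proof -
        have False if z: "z \<in> D1 p" "z \<in> D2 q" for z
        proof -
          have "z \<in> Z" using z L1 L2 \<open>p \<in> _\<close> \<open>q \<in> _\<close> by (auto simp: linkage_def Z_def)
          then have "z = p" "z = h q" using z m1[of p] m2[of q] \<open>p \<in> _\<close> \<open>q \<in> _\<close> by auto
          then show False using \<open>z \<in> Z\<close> \<open>p \<noteq> q\<close> uv by (auto simp: h_def Z_def split: if_splits)
        qed
        then show ?thesis by blast
      qed
      have "conn r (D1 p \<union> D2 p)" if p: "p \<in> insert u Z" for p
      proof (cases "p = u")
        case True
        then have "u \<in> D1 p" "v \<in> D2 p" using m1[OF p] m2[OF p] by (auto simp: h_def)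
        then show ?thesis
          using L1 L2 p uv vu by (intro conn_Un_edge[of r _ _ u v]) (auto simp: linkage_def)
      next
        case False
        then have "p \<in> D1 p" "p \<in> D2 p" using m1[OF p] m2[OF p] by (auto simp: h_def)
        then show ?thesis
          using L1 L2 p by (intro conn_Un_meet[of r _ _ p]) (auto simp: linkage_def)
      qed
      moreover have "disjoint_family_on (\<lambda>p. D1 p \<union> D2 p) (insert u Z)"
        unfolding disjoint_family_on_def
      proof (intro ballI impI)
        fix p q assume pq: "p \<in> insert u Z" "q \<in> insert u Z" "p \<noteq> q"
        then have "D1 p \<inter> D1 q = {}" "D2 p \<inter> D2 q = {}"
          using L1 L2 unfolding linkage_def disjoint_family_on_def by blast+
        then show "(D1 p \<union> D2 p) \<inter> (D1 q \<union> D2 q) = {}"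
          using cross[OF pq] cross[of q p] pq by auto
      qed
      ultimately have "linkage r V A B (insert u Z) (\<lambda>p. D1 p \<union> D2 p)"
        using L1 L2 V unfolding linkage_def by blast
      then show ?thesis using card finXY
        by (intro exI[of _ "insert u Z"] exI[of _ "\<lambda>p. D1 p \<union> D2 p"] conjI) simp_all
    qed
  qed
qed

text \<open>For \<open>k = card A\<close> the transversal lemma lets the points of \<open>A\<close>
  index the linkage, each member containing just its own starting point.\<close>

corollary menger_from:
  fixes r :: "'a rel"
  assumes "finite V" "sym r" "A \<subseteq> V" "B \<subseteq> V"
    and "\<And>X Y. separation r V X Y \<Longrightarrow> A \<subseteq> X \<Longrightarrow> B \<subseteq> Y \<Longrightarrow> card A \<le> card (X \<inter> Y)"
  obtains C where "linkage r V A B A C" "\<And>a. a \<in> A \<Longrightarrow> C a \<inter> A = {a}"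
proof -
  obtain I :: "'a set" and C where I: "finite I" "card I = card A" "linkage r V A B I C"
    using menger[OF assms] by blast
  then obtain g where "bij_betw g A I" "\<And>p. p \<in> A \<Longrightarrow> C (g p) \<inter> A = {p}"
    using disjoint_family_transversal[of C I A] finite_subset[OF assms(3,1)]
    unfolding linkage_def by auto
  then show thesis using that linkage_reindex[OF I(3)] by force
qed

section \<open>Sweeps with small boundary\<close>

locale rooted_relation =
  fixes V :: "'a set" and r :: "'a rel" and S :: "'a set" and n :: nat
  assumes finite_V: "finite V" and sym_r: "sym r" and r_subset: "r \<subseteq> V \<times> V"
begin

definition boundary :: "'a set \<Rightarrow> 'a set" where
  "boundary X = {v \<in> X. \<exists>w \<in> V - X. (v, w) \<in> r}"

text \<open>\<open>good X\<close> yields a rooted path decomposition of the part induced by \<open>X\<close> whose last bag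
  contains the boundary of \<open>X\<close>; the bag of a step from \<open>X\<close> to \<open>Y\<close> is
  \<open>boundary X \<union> boundary Y \<union> (S \<inter> (Y - X))\<close>, of size at most \<open>(n - 1) + n\<close>.\<close>

inductive good :: "'a set \<Rightarrow> bool" where
  good_empty: "good {}"
| good_step: "good X \<Longrightarrow> X \<subseteq> Y \<Longrightarrow> Y \<subseteq> V \<Longrightarrow> card (boundary X) < n \<Longrightarrow> card (boundary Y) < n \<Longrightarrow>
    card (boundary Y \<union> (S \<inter> (Y - X))) \<le> n \<Longrightarrow> good Y"

lemma boundary_subset: "boundary X \<subseteq> X"
  by (auto simp: boundary_def)

lemma good_subset: "good X \<Longrightarrow> X \<subseteq> V"
  by (induction rule: good.induct) auto

lemma finite_boundary: "X \<subseteq> V \<Longrightarrow> finite (boundary X)"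
  using boundary_subset finite_V by (meson finite_subset)

text \<open>The union and the intersection of the two sets counted on the left lie in the union and
  the intersection of those on the right. The weight \<open>T\<close> goes with the intersection
  only; it will carry the newly swept roots.\<close>

lemma boundary_submodular:
  assumes "X \<subseteq> V" "Y \<subseteq> V"
  shows "card (boundary (Y \<inter> X) \<union> (T \<inter> (Y \<inter> X))) + card (boundary (Y \<union> X))
    \<le> card (boundary X \<union> (T \<inter> X)) + card (boundary Y)"
proof -
  define P where "P = boundary (Y \<inter> X) \<union> (T \<inter> (Y \<inter> X))"
  define Q where "Q = boundary (Y \<union> X)"
  define P' where "P' = boundary X \<union> (T \<inter> X)"
  define Q' where "Q' = boundary Y"
  have fin: "finite P" "finite Q" "finite P'" "finite Q'"
    using assms finite_subset[OF _ finite_V]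
    by (auto simp: P_def Q_def P'_def Q'_def intro!: finite_boundary)
  have "P \<union> Q \<subseteq> P' \<union> Q'" "P \<inter> Q \<subseteq> P' \<inter> Q'"
    unfolding P_def Q_def P'_def Q'_def boundary_def by auto
  then have "card (P \<union> Q) \<le> card (P' \<union> Q')" "card (P \<inter> Q) \<le> card (P' \<inter> Q')"
    using fin by (auto intro: card_mono)
  then have "card P + card Q \<le> card P' + card Q'"
    using card_Un_Int[OF fin(1,2)] card_Un_Int[OF fin(3,4)] by linarith
  then show ?thesis by (simp add: P_def Q_def P'_def Q'_def)
qed

text \<open>Cuts an entire sweep of \<open>X\<close> down to \<open>Y\<close>. Since no set between
  \<open>Y\<close> and \<open>Y \<union> X\<close> has a smaller boundary than \<open>Y\<close>,
  submodularity shows that no boundary in the sweep grows under intersection with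
  \<open>Y\<close>.\<close>

lemma good_Int:
  assumes "good X" "Y \<subseteq> V"
    and "\<And>U. Y \<subseteq> U \<Longrightarrow> U \<subseteq> Y \<union> X \<Longrightarrow> card (boundary Y) \<le> card (boundary U)"
  shows "good (Y \<inter> X)"
  using assms
proof (induction rule: good.induct)
  case good_empty
  then show ?case by (simp add: good.good_empty)
next
  case (good_step W X)
  have le: "card (boundary Y) \<le> card (boundary U)" if "Y \<subseteq> U" "U \<subseteq> Y \<union> X" for U
    using good_step.prems(2) that by blast
  have W: "W \<subseteq> V" using good_step.hyps by auto
  have "good (Y \<inter> W)" using good_step le by blast
  moreover have "card (boundary Y) \<le> card (boundary (Y \<union> W))"
    using le[of "Y \<union> W"] good_step.hyps(2) by blast
  then have "card (boundary (Y \<inter> W)) < n"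
    using boundary_submodular[of W Y "{}"] W good_step.hyps good_step.prems(1) by simp
  moreover have leX: "card (boundary Y) \<le> card (boundary (Y \<union> X))"
    using le[of "Y \<union> X"] by blast
  then have "card (boundary (Y \<inter> X)) < n"
    using boundary_submodular[of X Y "{}"] good_step.hyps good_step.prems(1) by simp
  moreover have "card (boundary (Y \<inter> X) \<union> (S \<inter> (Y \<inter> X - Y \<inter> W))) \<le> n"
  proof -
    \<comment> \<open>The weight is the set of roots swept in this step, so boundary and new roots
      together do not grow either.\<close>
    let ?T = "S \<inter> (X - W)"
    have "card (boundary (Y \<inter> X) \<union> (?T \<inter> (Y \<inter> X))) \<le> card (boundary X \<union> (?T \<inter> X))"
      using boundary_submodular[of X Y ?T] leX good_step.hyps(3) good_step.prems(1) by auto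
    moreover have "?T \<inter> (Y \<inter> X) = S \<inter> (Y \<inter> X - Y \<inter> W)" "?T \<inter> X = ?T" by auto
    ultimately show ?thesis using good_step.hyps(6) by simp
  qed
  ultimately show ?case
    using good.good_step[of "Y \<inter> W" "Y \<inter> X"] good_step.hyps by blast
qed

lemma good_maximal_above:
  assumes "good Z" "card (boundary Z) \<le> m"
  obtains X where "good X" "Z \<subseteq> X" "card (boundary X) \<le> m"
    "\<And>Y. good Y \<Longrightarrow> X \<subseteq> Y \<Longrightarrow> card (boundary Y) \<le> m \<Longrightarrow> Y = X"
proof -
  let ?\<A> = "{X. good X \<and> card (boundary X) \<le> m}"
  have "finite ?\<A>"
    using good_subset finite_V by (auto intro!: finite_subset[of ?\<A> "Pow V"])
  with assms obtain X where "X \<in> ?\<A>" "Z \<subseteq> X" "\<forall>Y\<in>?\<A>. X \<subseteq> Y \<longrightarrow> X = Y"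
    using finite_has_maximal2[of ?\<A> Z] by auto
  then show thesis using that by blast
qed

lemma boundary_insert: "boundary (insert x X) \<subseteq> insert x (boundary X)"
  by (auto simp: boundary_def)

text \<open>The new boundary and the possible new root \<open>x\<close> all fit into
  \<open>insert x (boundary X)\<close>.\<close>

lemma good_insert:
  assumes "good X" "card (boundary X) < n" "x \<in> V" "card (boundary (insert x X)) < n"
  shows "good (insert x X)"
proof (rule good_step[OF assms(1)])
  have "card (boundary (insert x X) \<union> (S \<inter> (insert x X - X))) \<le> card (insert x (boundary X))"
    using boundary_insert finite_boundary[OF good_subset[OF assms(1)]]
    by (intro card_mono) auto
  also have "\<dots> \<le> n"
    using assms(2) finite_boundary[OF good_subset[OF assms(1)]] by (simp add: card_insert_if)
  finally show "card (boundary (insert x X) \<union> (S \<inter> (insert x X - X))) \<le> n" .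
qed (use assms good_subset in auto)

end

section \<open>Growing a model\<close>

text \<open>A construction order witnessing 1-degeneracy. \<open>p\<close> merely names the one
  admissible earlier neighbour of \<open>t\<close>; it need not be adjacent to \<open>t\<close> or
  lie in \<open>I\<close>, so a new vertex without earlier neighbours is covered.\<close>

inductive degenerate_order :: "'f rel \<Rightarrow> 'f set \<Rightarrow> bool" for a where
  empty: "degenerate_order a {}"
| insert: "degenerate_order a I \<Longrightarrow> t \<notin> I \<Longrightarrow> (\<And>q. q \<in> I \<Longrightarrow> (t, q) \<in> a \<Longrightarrow> q = p) \<Longrightarrow>
    degenerate_order a (insert t I)"

lemma degenerate_order_finite: "degenerate_order a I \<Longrightarrow> finite I"
  by (induction rule: degenerate_order.induct) auto

context rooted_relation
begin

definition partial_model :: "'f rel \<Rightarrow> 'f set \<Rightarrow> ('f \<Rightarrow> 'a set) \<Rightarrow> bool" where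
  "partial_model a I B \<longleftrightarrow> disjoint_family_on B I \<and>
     (\<forall>i\<in>I. conn r (B i) \<and> B i \<subseteq> V) \<and>
     (\<forall>i\<in>I. \<forall>j\<in>I. (i, j) \<in> a \<longrightarrow> (\<exists>u\<in>B i. \<exists>v\<in>B j. (u, v) \<in> r))"

text \<open>Each old branch set owns exactly one vertex of \<open>boundary X\<close> and is
  prolonged by the linkage member starting there; the member starting at \<open>x\<close> becomes
  the branch set of \<open>t\<close>. The target \<open>T\<close> is left open: it is the next
  boundary during growth and \<open>S\<close> at the end.\<close>

lemma partial_model_extend:
  assumes "sym a" "irrefl a" "t \<notin> I" "finite I"
    and B: "partial_model a I B" "\<And>i. i \<in> I \<Longrightarrow> B i \<subseteq> X" "\<And>i. i \<in> I \<Longrightarrow> B i \<inter> boundary X \<noteq> {}"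
    and X: "X \<subseteq> V" "card (boundary X) = card I"
    and x: "x \<in> V - X" "card (boundary (insert x X)) = Suc (card I)"
    and p: "\<And>q. q \<in> I \<Longrightarrow> (t, q) \<in> a \<Longrightarrow> \<exists>b \<in> B q \<inter> boundary X. (b, x) \<in> r"
    and C: "linkage r D (boundary (insert x X)) T (boundary (insert x X)) C"
      "\<And>v. v \<in> boundary (insert x X) \<Longrightarrow> C v \<inter> boundary (insert x X) = {v}"
    and D: "D \<subseteq> V" "D \<inter> insert x X \<subseteq> boundary (insert x X)"
  obtains B' where "partial_model a (insert t I) B'"
    "\<And>i. i \<in> insert t I \<Longrightarrow> B' i \<subseteq> X \<union> D" "\<And>i. i \<in> insert t I \<Longrightarrow> B' i \<inter> T \<noteq> {}"
proof -
  have fin: "finite (boundary X)" using X finite_boundary by blast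
  \<comment> \<open>The boundary of \<open>insert x X\<close> has one vertex more than that of
    \<open>X\<close>, so it gains \<open>x\<close> and loses nothing.\<close>
  have bd: "boundary (insert x X) = insert x (boundary X)"
    using boundary_insert fin x X by (intro card_seteq) (auto simp: card_insert_if)
  have xbd: "x \<notin> boundary X" using boundary_subset x by blast
  obtain g where g: "bij_betw g (boundary X) I"
    "\<And>v. v \<in> boundary X \<Longrightarrow> B (g v) \<inter> boundary X = {v}"
    using disjoint_family_transversal[of B I "boundary X"] B fin X assms(4)
    unfolding partial_model_def by auto
  define f where "f = inv_into (boundary X) g"
  have f: "f i \<in> boundary X" "B i \<inter> boundary X = {f i}" if "i \<in> I" for i
    using that g bij_betw_inv_into_right[OF g(1) that] unfolding f_def bij_betw_def
    by (metis inv_into_into, metis inv_into_into)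
  have f_inj: "i = j" if "i \<in> I" "j \<in> I" "f i = f j" for i j
    using that g(1) unfolding f_def by (metis bij_betw_inv_into_right)
  define B' where "B' = (\<lambda>i. if i = t then C x else B i \<union> C (f i))"
  have Cm: "C v \<inter> insert x (boundary X) = {v}" "conn r (C v)" "C v \<subseteq> D" "C v \<inter> T \<noteq> {}"
    if "v \<in> insert x (boundary X)" for v
    using C that unfolding bd linkage_def by auto
  have Cd: "C v \<inter> C w = {}" if "v \<in> insert x (boundary X)" "w \<in> insert x (boundary X)" "v \<noteq> w" for v w
    using C(1) that unfolding bd linkage_def disjoint_family_on_def by blast
  \<comment> \<open>A linkage member can touch an old branch set only at a boundary vertex, and each
    of the two has just one of those in common with \<open>boundary X\<close> and its extension by
    \<open>x\<close>, respectively.\<close>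
  have BC: "B i \<inter> C v = {}" if "i \<in> I" "v \<in> insert x (boundary X)" "v \<noteq> f i" for i v
  proof -
    have "B i \<inter> C v \<subseteq> insert x (boundary X)"
      using B(2)[OF that(1)] Cm(3)[OF that(2)] D(2) bd by auto
    moreover have "x \<notin> B i" using B(2)[OF that(1)] x by auto
    ultimately show ?thesis
      using Cm(1)[OF that(2)] f[OF that(1)] that(3) by auto
  qed
  have B't: "B' t = C x" by (simp add: B'_def)
  have B'I: "B' i = B i \<union> C (f i)" if "i \<in> I" for i
    using that assms(3) by (auto simp: B'_def)
  have "disjoint_family_on B' (insert t I)"
  proof -
    have 1: "B' i \<inter> B' t = {}" if "i \<in> I" for i
      using that BC[OF that, of x] Cd[of "f i" x] f[OF that] xbd by (auto simp: B't B'I)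
    have 2: "B' i \<inter> B' j = {}" if "i \<in> I" "j \<in> I" "i \<noteq> j" for i j
    proof -
      have "f i \<noteq> f j" using f_inj that by blast
      moreover have "B i \<inter> B j = {}"
        using B(1) that unfolding partial_model_def disjoint_family_on_def by blast
      ultimately show ?thesis
        using BC[OF that(1), of "f j"] BC[OF that(2), of "f i"] Cd[of "f i" "f j"] f that
        by (auto simp: B'I)
    qed
    show ?thesis
      unfolding disjoint_family_on_def using 1 2 by (metis Int_commute insertE)
  qed
  moreover have "conn r (B' i) \<and> B' i \<subseteq> X \<union> D \<and> B' i \<inter> T \<noteq> {}" if "i \<in> insert t I" for i
  proof (cases "i = t")
    case True
    then show ?thesis using Cm[of x] B't by auto
  next
    case False
    then have i: "i \<in> I" using that by auto
    have "f i \<in> B i" "f i \<in> C (f i)" using f[OF i] Cm(1)[of "f i"] by auto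
    then have "conn r (B i \<union> C (f i))"
      using B(1) i Cm(2)[of "f i"] f(1)[OF i] unfolding partial_model_def
      by (intro conn_Un_meet[of r _ _ "f i"]) auto
    then show ?thesis
      using B(2)[OF i] Cm[of "f i"] f(1)[OF i] by (auto simp: B'I[OF i])
  qed
  moreover have "\<exists>u\<in>B' i. \<exists>v\<in>B' j. (u, v) \<in> r"
    if ij: "i \<in> insert t I" "j \<in> insert t I" "(i, j) \<in> a" for i j
  proof -
    have x: "x \<in> B' t" using Cm(1)[of x] B't by auto
    have *: "\<exists>b\<in>B' q. (b, x) \<in> r" if "q \<in> I" "(t, q) \<in> a" for q
      using p[OF that] B'I[OF that(1)] by auto
    consider "i = t" "j \<in> I" | "j = t" "i \<in> I" | "i \<in> I" "j \<in> I"
      using ij assms(2) by (auto simp: irrefl_def)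
    then show ?thesis
    proof cases
      case 1
      then show ?thesis using *[of j] x ij(3) sym_r by (metis symD)
    next
      case 2
      then show ?thesis using *[of i] x ij(3) assms(1) by (metis symD)
    next
      case 3
      then show ?thesis using B(1) ij(3) B'I unfolding partial_model_def by blast
    qed
  qed
  ultimately show thesis
    using that[of B'] X D(1) unfolding partial_model_def by (metis Un_least order_trans)
qed

section \<open>Extremal sets of the sweep\<close>

definition extremal :: "nat \<Rightarrow> 'a set \<Rightarrow> bool" where
  "extremal m X \<longleftrightarrow> good X \<and> card (boundary X) \<le> m \<and>
     (\<forall>Y. good Y \<longrightarrow> X \<subseteq> Y \<longrightarrow> card (boundary Y) \<le> m \<longrightarrow> Y = X)"

text \<open>If \<open>p\<close> is an earlier neighbour of \<open>t\<close>, a boundary vertex in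
  its branch set has a neighbour \<open>x\<close> outside \<open>X\<close>; otherwise any vertex
  outside \<open>X\<close> will do. A boundary of size at most \<open>m\<close> would make
  \<open>insert x X\<close> good, against maximality.\<close>

lemma extremal_attachment:
  assumes "extremal m X" "\<not> good V" "m < n"
    and B: "partial_model a I B" "\<And>i. i \<in> I \<Longrightarrow> B i \<subseteq> X" "\<And>i. i \<in> I \<Longrightarrow> B i \<inter> boundary X \<noteq> {}"
    and p: "\<And>q. q \<in> I \<Longrightarrow> (t, q) \<in> a \<Longrightarrow> q = p"
  obtains x where "x \<in> V - X" "card (boundary (insert x X)) = Suc m"
    "\<And>q. q \<in> I \<Longrightarrow> (t, q) \<in> a \<Longrightarrow> \<exists>b \<in> B q \<inter> boundary X. (b, x) \<in> r"
proof -
  have X: "good X" "card (boundary X) \<le> m" "X \<subseteq> V"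
    and max: "\<And>Y. good Y \<Longrightarrow> X \<subseteq> Y \<Longrightarrow> card (boundary Y) \<le> m \<Longrightarrow> Y = X"
    using assms(1) good_subset by (auto simp: extremal_def)
  have "\<exists>x \<in> V - X. \<forall>q. q \<in> I \<longrightarrow> (t, q) \<in> a \<longrightarrow> (\<exists>b \<in> B q \<inter> boundary X. (b, x) \<in> r)"
  proof (cases "p \<in> I \<and> (t, p) \<in> a")
    case True
    then obtain b where b: "b \<in> B p \<inter> boundary X" using B(3) by blast
    then obtain x where "x \<in> V - X" "(b, x) \<in> r" by (auto simp: boundary_def)
    then show ?thesis using b p by blast
  next
    case False
    have "X \<noteq> V" using X(1) assms(2) by blast
    then show ?thesis using False p X(3) by blast
  qed
  then obtain x where x: "x \<in> V - X"
    "\<And>q. q \<in> I \<Longrightarrow> (t, q) \<in> a \<Longrightarrow> \<exists>b \<in> B q \<inter> boundary X. (b, x) \<in> r" by blast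
  have "card (boundary (insert x X)) \<le> card (insert x (boundary X))"
    using boundary_insert finite_boundary[OF X(3)] by (intro card_mono) auto
  then have "card (boundary (insert x X)) \<le> Suc m"
    using X(2) finite_boundary[OF X(3)] by (auto simp: card_insert_if split: if_splits)
  moreover have "\<not> card (boundary (insert x X)) \<le> m"
    using good_insert[OF X(1)] max[of "insert x X"] X(2) x(1) assms(3) by auto
  ultimately show thesis using that x by force
qed

text \<open>A separator of size at most \<open>m\<close> would give a set between
  \<open>insert x X\<close> and \<open>Y\<close> with boundary at most \<open>m\<close>. A set of
  least boundary in that range is good and exceeds \<open>X\<close>, against maximality.\<close>

lemma extremal_linkage:
  assumes X: "extremal m X" and Y: "good Y" "insert x X \<subseteq> Y" "card (boundary Y) \<le> Suc m"
    and x: "x \<in> V - X" "card (boundary (insert x X)) = Suc m"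
  obtains C where
    "linkage r (Y - (insert x X - boundary (insert x X))) (boundary (insert x X)) (boundary Y)
      (boundary (insert x X)) C"
    "\<And>v. v \<in> boundary (insert x X) \<Longrightarrow> C v \<inter> boundary (insert x X) = {v}"
proof -
  define X' where "X' = insert x X"
  define D where "D = Y - (X' - boundary X')"
  have V: "X' \<subseteq> V" "Y \<subseteq> V" using good_subset[OF Y(1)] Y(2) by (auto simp: X'_def)
  have "card (boundary X') \<le> card (P \<inter> Q)"
    if PQ: "separation r D P Q" "boundary X' \<subseteq> P" "boundary Y \<subseteq> Q" for P Q
  proof (rule ccontr)
    assume less: "\<not> ?thesis"
    have D': "D = P \<union> Q" "r \<inter> (P - Q) \<times> (Q - P) = {}" using PQ(1) by (auto simp: separation_def)
    \<comment> \<open>An edge leaving \<open>X' \<union> P\<close> either stays in \<open>Y\<close>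
      and ends in \<open>Q\<close>, or leaves \<open>Y\<close> and starts in
      \<open>boundary Y\<close>, which lies in \<open>Q\<close>.\<close>
    have "boundary (X' \<union> P) \<subseteq> P \<inter> Q"
    proof
      fix v assume "v \<in> boundary (X' \<union> P)"
      then obtain w where v: "v \<in> X' \<union> P" and w: "w \<in> V" "w \<notin> X'" "w \<notin> P" "(v, w) \<in> r"
        by (auto simp: boundary_def)
      have vP: "v \<in> P" using v w PQ(2) by (auto simp: boundary_def)
      moreover have "v \<in> Q"
      proof (cases "w \<in> Y")
        case True
        then have "w \<in> Q" using w D'(1) by (auto simp: D_def)
        then show ?thesis using D'(2) w vP by blast
      next
        case False
        moreover have "v \<in> Y" using vP D'(1) by (auto simp: D_def)
        ultimately show ?thesis using w PQ(3) by (auto simp: boundary_def)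
      qed
      ultimately show "v \<in> P \<inter> Q" by blast
    qed
    moreover have finP: "finite (P \<inter> Q)"
      using D'(1) V by (intro finite_subset[OF _ finite_V]) (auto simp: D_def)
    ultimately have "card (boundary (X' \<union> P)) \<le> card (P \<inter> Q)" by (intro card_mono)
    then have le: "card (boundary (X' \<union> P)) \<le> m"
      using less x(2) unfolding X'_def[symmetric] by linarith
    have PY: "X' \<subseteq> X' \<union> P" "X' \<union> P \<subseteq> Y" using D'(1) Y(2) by (auto simp: D_def X'_def)
    \<comment> \<open>\<open>X' \<union> P\<close> itself need not be good, so a set of least
      boundary between \<open>X'\<close> and \<open>Y\<close> replaces it; to this one
      \<open>good_Int\<close> applies.\<close>
    have "\<exists>U. (X' \<subseteq> U \<and> U \<subseteq> Y) \<and>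
        (\<forall>W. X' \<subseteq> W \<and> W \<subseteq> Y \<longrightarrow> card (boundary U) \<le> card (boundary W))"
      using ex_has_least_nat[of "\<lambda>U. X' \<subseteq> U \<and> U \<subseteq> Y" "X' \<union> P" "\<lambda>U. card (boundary U)"] PY by auto
    then obtain U where U: "X' \<subseteq> U" "U \<subseteq> Y"
      and min: "\<And>W. X' \<subseteq> W \<Longrightarrow> W \<subseteq> Y \<Longrightarrow> card (boundary U) \<le> card (boundary W)"
      by auto
    have "good (U \<inter> Y)"
    proof (rule good_Int[OF Y(1)])
      show "U \<subseteq> V" using U V by auto
      fix W assume "U \<subseteq> W" "W \<subseteq> U \<union> Y"
      then show "card (boundary U) \<le> card (boundary W)" using U by (intro min) auto
    qed
    moreover have "U \<inter> Y = U" using U by auto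
    moreover have "card (boundary U) \<le> m" using min[OF PY] le by auto
    ultimately have "U = X" using X U(1) unfolding extremal_def X'_def by auto
    then show False using U(1) x by (auto simp: X'_def)
  qed
  moreover have "boundary X' \<subseteq> D" "boundary Y \<subseteq> D"
    using boundary_subset[of X'] boundary_subset[of Y] Y(2) V
    by (auto simp: D_def X'_def boundary_def)
  moreover have "finite D" using V finite_V by (auto simp: D_def intro: finite_subset)
  ultimately obtain C where "linkage r D (boundary X') (boundary Y) (boundary X') C"
    "\<And>v. v \<in> boundary X' \<Longrightarrow> C v \<inter> boundary X' = {v}"
    using menger_from[of D r "boundary X'" "boundary Y"] sym_r by metis
  then show thesis using that unfolding D_def X'_def by blast
qed

text \<open>If fewer than \<open>n\<close> vertices separate the new boundary from the roots,
  everything on the near side can be swept from \<open>X\<close> in one step: its boundary and its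
  new roots all lie on the separator. This contradicts maximality.\<close>

lemma extremal_rooted_linkage:
  assumes X: "extremal m X" and m: "Suc m = n"
    and x: "x \<in> V - X" "card (boundary (insert x X)) = Suc m"
  obtains C where
    "linkage r (V - (insert x X - boundary (insert x X))) (boundary (insert x X)) S
      (boundary (insert x X)) C"
    "\<And>v. v \<in> boundary (insert x X) \<Longrightarrow> C v \<inter> boundary (insert x X) = {v}"
proof -
  define X' where "X' = insert x X"
  define D where "D = V - (X' - boundary X')"
  have good: "good X" "card (boundary X) < n" and XV: "X \<subseteq> V"
    using X m good_subset by (auto simp: extremal_def)
  have V: "X' \<subseteq> V" using XV x by (auto simp: X'_def)
  \<comment> \<open>This serves the count of roots below: if \<open>x\<close> is a root, it lies in
    both \<open>P\<close> and \<open>Q\<close>, hence on the separator.\<close>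
  have xb: "x \<in> boundary X'"
  proof (rule ccontr)
    assume "x \<notin> boundary X'"
    then have "boundary X' \<subseteq> boundary X" using boundary_insert unfolding X'_def by blast
    then have "card (boundary X') \<le> card (boundary X)"
      by (intro card_mono finite_boundary[OF XV])
    then have "card (boundary X') \<le> m" using X by (simp add: extremal_def)
    then show False using x(2) by (simp add: X'_def)
  qed
  have "card (boundary X') \<le> card (P \<inter> Q)"
    if PQ: "separation r D P Q" "boundary X' \<subseteq> P" "S \<inter> D \<subseteq> Q" for P Q
  proof (rule ccontr)
    assume less: "\<not> ?thesis"
    have D': "D = P \<union> Q" "r \<inter> (P - Q) \<times> (Q - P) = {}" using PQ(1) by (auto simp: separation_def)
    have sub: "boundary (X' \<union> P) \<subseteq> P \<inter> Q"
    proof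
      fix v assume "v \<in> boundary (X' \<union> P)"
      then obtain w where v: "v \<in> X' \<union> P" and w: "w \<in> V" "w \<notin> X'" "w \<notin> P" "(v, w) \<in> r"
        by (auto simp: boundary_def)
      have vP: "v \<in> P" using v w PQ(2) by (auto simp: boundary_def)
      have "w \<in> Q" using w D'(1) by (auto simp: D_def)
      then show "v \<in> P \<inter> Q" using D'(2) w vP by blast
    qed
    have root: "S \<inter> (X' \<union> P - X) \<subseteq> P \<inter> Q"
      using PQ(2,3) xb D'(1) unfolding X'_def by blast
    have finP: "finite (P \<inter> Q)"
      using D'(1) by (intro finite_subset[OF _ finite_V]) (auto simp: D_def)
    have small: "card (P \<inter> Q) \<le> m" using less x(2) unfolding X'_def[symmetric] by simp
    have le: "card (boundary (X' \<union> P)) \<le> m"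
      using card_mono[OF finP sub] small by simp
    have "good (X' \<union> P)"
    proof (rule good_step[OF good(1)])
      show "card (boundary (X' \<union> P) \<union> S \<inter> (X' \<union> P - X)) \<le> n"
        using card_mono[OF finP, of "boundary (X' \<union> P) \<union> S \<inter> (X' \<union> P - X)"] sub root small m by auto
    qed (use good V D'(1) le m in \<open>auto simp: X'_def D_def\<close>)
    then have "X' \<union> P = X" using X le unfolding extremal_def X'_def by blast
    then show False using x by (auto simp: X'_def)
  qed
  moreover have "boundary X' \<subseteq> D"
    using boundary_subset[of X'] V by (auto simp: D_def)
  moreover have "finite D" using finite_V by (auto simp: D_def)
  ultimately obtain C where "linkage r D (boundary X') (S \<inter> D) (boundary X') C"
    "\<And>v. v \<in> boundary X' \<Longrightarrow> C v \<inter> boundary X' = {v}"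
    using menger_from[of D r "boundary X'" "S \<inter> D"] sym_r by (metis Int_lower2)
  moreover from this(1) have "linkage r D (boundary X') S (boundary X') C"
    unfolding linkage_def by blast
  ultimately show thesis using that unfolding D_def X'_def by blast
qed

lemma extremal_exists: "good Z \<Longrightarrow> card (boundary Z) \<le> m \<Longrightarrow> \<exists>X. Z \<subseteq> X \<and> extremal m X"
  unfolding extremal_def by (metis good_maximal_above)

lemma partial_model_grow:
  assumes "degenerate_order a I" "card I < n" "\<not> good V" "sym a" "irrefl a"
  shows "\<exists>X B. extremal (card I) X \<and> card (boundary X) = card I \<and> partial_model a I B \<and>
    (\<forall>i\<in>I. B i \<subseteq> X \<and> B i \<inter> boundary X \<noteq> {})"
  using assms
proof (induction rule: degenerate_order.induct)
  case empty
  obtain X where "extremal 0 X"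
    using extremal_exists[OF good_empty, of 0] by (auto simp: boundary_def)
  then show ?case
    by (intro exI[of _ X]) (auto simp: extremal_def partial_model_def disjoint_family_on_def)
next
  case (insert I t p)
  have fin: "finite I" using insert.hyps(1) by (rule degenerate_order_finite)
  have card: "card (insert t I) = Suc (card I)" using fin insert.hyps(2) by simp
  then obtain X B where X: "extremal (card I) X" "card (boundary X) = card I"
    and B: "partial_model a I B" "\<And>i. i \<in> I \<Longrightarrow> B i \<subseteq> X" "\<And>i. i \<in> I \<Longrightarrow> B i \<inter> boundary X \<noteq> {}"
    using insert.IH insert.prems by auto
  have gX: "good X" "X \<subseteq> V" using X(1) good_subset by (auto simp: extremal_def)
  have less: "card I < n" "Suc (card I) < n" using insert.prems(1) card by auto
  obtain x where x: "x \<in> V - X" "card (boundary (insert x X)) = Suc (card I)"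
    "\<And>q. q \<in> I \<Longrightarrow> (t, q) \<in> a \<Longrightarrow> \<exists>b \<in> B q \<inter> boundary X. (b, x) \<in> r"
    using extremal_attachment[OF X(1) insert.prems(2) less(1) B insert.hyps(3)] by metis
  have "good (insert x X)" using good_insert[OF gX(1)] X(2) x less by auto
  then obtain Y where Y: "insert x X \<subseteq> Y" "extremal (Suc (card I)) Y"
    using extremal_exists x(2) by (metis order_refl)
  have gY: "good Y" "card (boundary Y) \<le> Suc (card I)" using Y(2) by (auto simp: extremal_def)
  have YV: "Y \<subseteq> V" using good_subset gY by auto
  have "Y \<noteq> X" using Y(1) x by auto
  \<comment> \<open>A smaller boundary would make \<open>Y\<close> a proper good superset of
    \<open>X\<close> with boundary at most \<open>card I\<close>, against maximality of
    \<open>X\<close>.\<close>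
  then have cY: "card (boundary Y) = Suc (card I)"
    using X(1) Y(1) gY unfolding extremal_def by (metis insert_subset le_SucE)
  let ?D = "Y - (insert x X - boundary (insert x X))"
  obtain C where C: "linkage r ?D (boundary (insert x X)) (boundary Y) (boundary (insert x X)) C"
      "\<And>v. v \<in> boundary (insert x X) \<Longrightarrow> C v \<inter> boundary (insert x X) = {v}"
    using extremal_linkage[OF X(1) gY(1) Y(1) gY(2) x(1,2)] by metis
  have D: "?D \<subseteq> V" "?D \<inter> insert x X \<subseteq> boundary (insert x X)" using YV by auto
  obtain B' where B': "partial_model a (insert t I) B'"
    "\<And>i. i \<in> insert t I \<Longrightarrow> B' i \<subseteq> X \<union> ?D" "\<And>i. i \<in> insert t I \<Longrightarrow> B' i \<inter> boundary Y \<noteq> {}"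
    using partial_model_extend[OF insert.prems(3,4) insert.hyps(2) fin B gX(2) X(2) x C D] by metis
  moreover have "X \<union> ?D \<subseteq> Y" using Y(1) by auto
  ultimately show ?case using Y(2) cY card by (intro exI[of _ Y] exI[of _ B']) force
qed

text \<open>For the last vertex \<open>t\<close> of the order, \<open>insert x X\<close> has a
  boundary of size \<open>n\<close>, too large for a step of the sweep. So this boundary is linked
  directly to \<open>S\<close> instead of to a further extremal set.\<close>

theorem rooted_partial_model:
  assumes "degenerate_order a W" "card W = n" "0 < n" "\<not> good V" "sym a" "irrefl a"
  obtains B where "partial_model a W B" "\<And>i. i \<in> W \<Longrightarrow> B i \<inter> S \<noteq> {}"
  using assms(1)
proof cases
  case empty
  then show ?thesis using assms(2,3) by simp
next
  case (insert I t p)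
  have fin: "finite I" using insert(2) by (rule degenerate_order_finite)
  have card: "Suc (card I) = n" using fin insert(1,3) assms(2) by simp
  then obtain X B where X: "extremal (card I) X" "card (boundary X) = card I"
    and B: "partial_model a I B" "\<And>i. i \<in> I \<Longrightarrow> B i \<subseteq> X" "\<And>i. i \<in> I \<Longrightarrow> B i \<inter> boundary X \<noteq> {}"
    using partial_model_grow[OF insert(2) _ assms(4-6)] by auto
  have XV: "X \<subseteq> V" using X(1) good_subset by (auto simp: extremal_def)
  have less: "card I < n" using card by simp
  obtain x where x: "x \<in> V - X" "card (boundary (insert x X)) = Suc (card I)"
    "\<And>q. q \<in> I \<Longrightarrow> (t, q) \<in> a \<Longrightarrow> \<exists>b \<in> B q \<inter> boundary X. (b, x) \<in> r"
    using extremal_attachment[OF X(1) assms(4) less B insert(4)] by metis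
  let ?D = "V - (insert x X - boundary (insert x X))"
  obtain C where C: "linkage r ?D (boundary (insert x X)) S (boundary (insert x X)) C"
      "\<And>v. v \<in> boundary (insert x X) \<Longrightarrow> C v \<inter> boundary (insert x X) = {v}"
    using extremal_rooted_linkage[OF X(1) card x(1,2)] by metis
  have D: "?D \<subseteq> V" "?D \<inter> insert x X \<subseteq> boundary (insert x X)" by auto
  show thesis
    using partial_model_extend[OF assms(5,6) insert(3) fin B XV X(2) x C D] that insert(1) by metis
qed

end

section \<open>From a complete sweep to a path decomposition\<close>

lemma convex_nat_set_interval:
  fixes K :: "nat set"
  assumes "finite K" "K \<noteq> {}"
    and "\<And>i j k. i \<in> K \<Longrightarrow> j \<in> K \<Longrightarrow> i \<le> k \<Longrightarrow> k \<le> j \<Longrightarrow> k \<in> K"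
  shows "\<exists>i j. i \<le> j \<and> K = {i..j}"
proof (intro exI conjI)
  show "Min K \<le> Max K" using assms(1,2) by simp
  show "K = {Min K..Max K}"
    using assms(1,2) assms(3)[OF Min_in[OF assms(1,2)] Max_in[OF assms(1,2)]]
    by (intro equalityI subsetI) simp_all
qed

context rooted_relation
begin

definition bag :: "'a set \<Rightarrow> 'a set \<Rightarrow> 'a set" where
  "bag X Y = boundary X \<union> boundary Y \<union> (S \<inter> (Y - X))"

lemma good_chain:
  assumes "good Y"
  shows "\<exists>X m. X 0 = {} \<and> X m = Y \<and> (\<forall>k<m. X k \<subseteq> X (Suc k) \<and> X (Suc k) \<subseteq> V \<and>
    card (bag (X k) (X (Suc k))) \<le> 2 * n - 1)"
  using assms
proof (induction rule: good.induct)
  case good_empty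
  then show ?case by (intro exI[of _ "\<lambda>_. {}"] exI[of _ 0]) auto
next
  case (good_step Z Y)
  then obtain X m where X: "X 0 = {}" "X m = Z" "\<forall>k<m. X k \<subseteq> X (Suc k) \<and> X (Suc k) \<subseteq> V \<and>
    card (bag (X k) (X (Suc k))) \<le> 2 * n - 1" by blast
  have "card (bag Z Y) \<le> card (boundary Z) + card (boundary Y \<union> (S \<inter> (Y - Z)))"
    unfolding bag_def Un_assoc by (rule card_Un_le)
  then have "card (bag Z Y) \<le> 2 * n - 1" using good_step.hyps by linarith
  then show ?case using X good_step.hyps(2,3)
    by (intro exI[of _ "X(Suc m := Y)"] exI[of _ "Suc m"]) (auto simp: less_Suc_eq)
qed

text \<open>\<open>l v\<close> is the step in which \<open>v\<close> is swept. An edge between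
  different steps puts its earlier end on a boundary; so each neighbour of a vertex outside all bags
  lies in the bag of that vertex's step, or is outside all bags and swept in the same step.\<close>

lemma good_bags:
  assumes "good V" "S \<subseteq> V"
  obtains W :: "nat \<Rightarrow> 'a set" and l :: "'a \<Rightarrow> nat" and m U where
    "0 < m" "U = (\<Union>k<m. W k)" "U \<subseteq> V" "S \<subseteq> U"
    "\<And>k. k < m \<Longrightarrow> card (W k) \<le> 2 * n - 1"
    "\<And>u v. u \<in> U \<Longrightarrow> v \<in> U \<Longrightarrow> (u, v) \<in> r \<Longrightarrow> \<exists>k<m. u \<in> W k \<and> v \<in> W k"
    "\<And>v. v \<in> U \<Longrightarrow> \<exists>i j. i \<le> j \<and> {k. k < m \<and> v \<in> W k} = {i..j}"
    "\<And>v. v \<in> V \<Longrightarrow> l v < m"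
    "\<And>u w. u \<in> V - U \<Longrightarrow> (u, w) \<in> r \<Longrightarrow> (if w \<in> U then w \<in> W (l u) else l w = l u)"
proof -
  obtain X0 m0 where X0: "X0 0 = {}" "X0 m0 = V" "\<forall>k<m0. X0 k \<subseteq> X0 (Suc k) \<and> X0 (Suc k) \<subseteq> V \<and>
    card (bag (X0 k) (X0 (Suc k))) \<le> 2 * n - 1"
    using good_chain[OF assms(1)] by blast
  \<comment> \<open>A final idle step from \<open>V\<close> to \<open>V\<close>, with empty bag,
    guarantees at least one bag even for empty \<open>V\<close>.\<close>
  define m where "m = Suc m0"
  define X where "X = X0(m := V)"
  have "bag V V = {}" by (auto simp: bag_def boundary_def)
  then have chain: "X k \<subseteq> X (Suc k) \<and> X (Suc k) \<subseteq> V \<and> card (bag (X k) (X (Suc k))) \<le> 2 * n - 1"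
    if "k < m" for k
    using that X0 by (auto simp: X_def m_def less_Suc_eq)
  have X: "X 0 = {}" "X m = V" using X0 by (auto simp: X_def m_def)
  have mono: "X i \<subseteq> X j" if "i \<le> j" "j \<le> m" for i j
    using that
  proof (induction rule: dec_induct)
    case (step j)
    then show ?case using chain[of j] by auto
  qed simp
  define W where "W = (\<lambda>k. bag (X k) (X (Suc k)))"
  define U where "U = (\<Union>k<m. W k)"
  have WX: "W k \<subseteq> X (Suc k)" if "k < m" for k
    using chain[OF that] boundary_subset unfolding W_def bag_def by fast
  \<comment> \<open>A vertex swept before step \<open>j\<close> is in bag \<open>j\<close> only if
    it still has an unswept neighbour, so it was on every boundary since it was swept. This makes
    its bags an interval.\<close>
  have leave: "v \<in> boundary (X k)"
    if v: "v \<in> X k" "v \<in> W j" "k \<le> j" "j < m" for v j k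
  proof -
    have sub: "X k \<subseteq> X j" "X j \<subseteq> X (Suc j)" using mono chain v by auto
    then have "v \<in> X j" using v by auto
    then obtain w where "w \<in> V - X j" "(v, w) \<in> r"
      using v(2) sub by (auto simp: W_def bag_def boundary_def)
    then show ?thesis using v(1) sub by (auto simp: boundary_def)
  qed
  define l where "l = (\<lambda>v. LEAST k. v \<in> X (Suc k))"
  have l: "l v < m" "v \<in> X (Suc (l v))" "v \<notin> X (l v)" if "v \<in> V" for v
  proof -
    have m1: "v \<in> X (Suc m0)" using that X by (simp add: m_def)
    have "l v \<le> m0" unfolding l_def by (rule Least_le) (rule m1)
    then show "l v < m" by (simp add: m_def)
    show "v \<in> X (Suc (l v))" unfolding l_def by (rule LeastI[of _ m0]) (rule m1)
    show "v \<notin> X (l v)"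
    proof (cases "l v")
      case (Suc k)
      then have "k < l v" by simp
      then show ?thesis using not_less_Least[of k "\<lambda>k. v \<in> X (Suc k)"] Suc unfolding l_def by simp
    qed (use X in simp)
  qed
  have l_eq: "l v = k" if "v \<in> X (Suc k)" "v \<notin> X k" "k < m" for v k
  proof -
    have v: "v \<in> V" using that chain by auto
    have "\<not> k < l v" using mono[of "Suc k" "l v"] l[OF v] that by auto
    moreover have "\<not> l v < k" using mono[of "Suc (l v)" k] l[OF v] that by auto
    ultimately show ?thesis by simp
  qed
  \<comment> \<open>A vertex in any bag is also in that of its own step, so edges within one step
    are covered.\<close>
  have home: "v \<in> W (l v)" if vU: "v \<in> U" and vV: "v \<in> V" for v
  proof -
    obtain j where j: "j < m" "v \<in> W j" using vU by (auto simp: U_def)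
    have "v \<in> X (Suc j)" using j WX by auto
    then have "l v \<le> j" unfolding l_def by (rule Least_le)
    show ?thesis
    proof (cases "l v = j")
      case False
      then have "v \<in> boundary (X (Suc (l v)))"
        using leave[OF l(2)[OF vV] j(2)] \<open>l v \<le> j\<close> j(1) by auto
      then show ?thesis by (simp add: W_def bag_def)
    qed (use j in simp)
  qed
  have UV: "U \<subseteq> V" using WX chain by (fastforce simp: U_def)
  have S: "S \<subseteq> U"
  proof
    fix s assume s: "s \<in> S"
    then have "s \<in> V" using assms(2) by auto
    then have "s \<in> W (l s)" using l[of s] s by (auto simp: W_def bag_def)
    then show "s \<in> U" using l(1)[of s] \<open>s \<in> V\<close> by (auto simp: U_def)
  qed
  have edge: "u \<in> W (l v)" if "u \<in> V" "v \<in> V" "(u, v) \<in> r" "l u < l v" for u v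
  proof -
    have "u \<in> X (l v)" using mono[of "Suc (l u)" "l v"] l[OF that(1)] l(1)[OF that(2)] that(4) by auto
    then have "u \<in> boundary (X (l v))"
      using l(3)[OF that(2)] that(2,3) by (auto simp: boundary_def)
    then show ?thesis by (simp add: W_def bag_def)
  qed
  have edges: "\<exists>k<m. u \<in> W k \<and> v \<in> W k" if "u \<in> U" "v \<in> U" "(u, v) \<in> r" for u v
  proof -
    have V: "u \<in> V" "v \<in> V" using that UV by auto
    consider "l u = l v" | "l u < l v" | "l v < l u" by linarith
    then show ?thesis
    proof cases
      case 1 then show ?thesis using home l(1) V that by metis
    next
      case 2 then show ?thesis using home[OF that(2)] l(1) V edge that by metis
    next
      case 3
      have "(v, u) \<in> r" using that(3) sym_r by (auto dest: symD)
      then show ?thesis using 3 home[OF that(1)] l(1) V edge by metis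
    qed
  qed
  have interval: "\<exists>i j. i \<le> j \<and> {k. k < m \<and> v \<in> W k} = {i..j}" if "v \<in> U" for v
  proof (rule convex_nat_set_interval)
    show "{k. k < m \<and> v \<in> W k} \<noteq> {}" using that by (auto simp: U_def)
    fix i j k assume k: "i \<in> {k. k < m \<and> v \<in> W k}" "j \<in> {k. k < m \<and> v \<in> W k}" "i \<le> k" "k \<le> j"
    show "k \<in> {k. k < m \<and> v \<in> W k}"
    proof (cases "i = k")
      case False
      then have "v \<in> X k" using k WX[of i] mono[of "Suc i" k] by auto
      then have "v \<in> boundary (X k)" using leave k by auto
      then show ?thesis using k by (auto simp: W_def bag_def)
    qed (use k in simp)
  qed simp
  have outside: "if w \<in> U then w \<in> W (l u) else l w = l u"
    if u: "u \<in> V - U" and e: "(u, w) \<in> r" for u w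
  proof -
    have w: "w \<in> V" using e r_subset by auto
    have U: "x \<in> U" if "x \<in> W k" "k < m" for x k using that by (auto simp: U_def)
    have "(w, u) \<in> r" using e sym_r by (auto dest: symD)
    then have 1: "w \<in> W (l u)" if "l w < l u" using edge[OF w _ _ that] u by auto
    \<comment> \<open>A neighbour swept later would put \<open>u\<close> on a boundary, hence into
      \<open>U\<close>.\<close>
    have 2: "\<not> l u < l w"
    proof
      assume less: "l u < l w"
      have "w \<notin> X (Suc (l u))"
        using mono[of "Suc (l u)" "l w"] l(1,3)[OF w] less by auto
      then have "u \<in> boundary (X (Suc (l u)))"
        using l(2)[of u] u w e by (auto simp: boundary_def)
      then show False using U[of u "l u"] l(1)[of u] u by (auto simp: W_def bag_def)
    qed
    show ?thesis
    proof (cases "l w = l u")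
      case True then show ?thesis using home[OF _ w] by auto
    next
      case False
      then have "w \<in> W (l u)" using 1 2 by auto
      then show ?thesis using U l(1)[of u] u by auto
    qed
  qed
  show thesis
  proof (rule that[of m U W l])
    show "0 < m" by (simp add: m_def)
    show "card (W k) \<le> 2 * n - 1" if "k < m" for k using chain[OF that] by (simp add: W_def)
  qed (fact U_def UV S edges interval l(1) outside)+
qed

end

section \<open>Connectedness and components in the graph library\<close>

lemma connected_iff_conn:
  "connected G \<longleftrightarrow> conn (arcs_ends (with_proj (mk_symmetric G))) (verts G)"
  by (simp add: connected_def strongly_connected_def conn_def reachable_def mk_symmetric_def)

lemma arcs_ends_mk_symmetric:
  "arcs_ends (with_proj (mk_symmetric G)) = arcs_ends G \<union> (arcs_ends G)\<inverse>"
  by (auto simp: mk_symmetric_def arcs_ends_def arc_to_ends_def image_iff)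

lemma arcs_ends_induce_subgraph:
  "arcs_ends (G \<restriction> U) = arcs_ends G \<inter> U \<times> U"
  by (auto simp: arcs_ends_conv induce_subgraph_def)

lemma conn_imp_connected:
  assumes "conn (arcs_ends G) U"
  shows "connected (G \<restriction> U)"
proof -
  have "(u, v) \<in> rtrancl_on U (arcs_ends G \<inter> U \<times> U)" if "(u, v) \<in> rtrancl_on U (arcs_ends G)" for u v
    using that by induction (auto intro: converse_rtrancl_on_into_rtrancl_on)
  then have "conn (arcs_ends G \<inter> U \<times> U) U" using assms by (auto simp: conn_def)
  then have "conn (arcs_ends G \<inter> U \<times> U \<union> (arcs_ends G \<inter> U \<times> U)\<inverse>) U"
    by (rule conn_mono) auto
  then show ?thesis
    unfolding connected_iff_conn arcs_ends_mk_symmetric arcs_ends_induce_subgraph by simp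
qed

text \<open>Components are maximal as subgraphs, so the competitor must carry arcs: the induced
  subgraph on \<open>verts C \<union> {w}\<close> contains \<open>C\<close> and is connected through
  the edge to \<open>w\<close>.\<close>

lemma component_closed:
  assumes "wf_digraph G" "component G C" "u \<in> verts C" "u \<rightarrow>\<^bsub>G\<^esub> w"
  shows "w \<in> verts C"
proof (rule ccontr)
  assume w: "w \<notin> verts C"
  interpret wf_digraph G by fact
  have C: "subgraph C G" "connected C"
    and max: "\<And>H. H \<noteq> C \<Longrightarrow> subgraph C H \<Longrightarrow> subgraph H G \<Longrightarrow> \<not> connected H"
    using assms(2) unfolding component_def max_subgraph_def by auto
  let ?H = "G \<restriction> (verts C \<union> {w})"
  have "w \<in> verts G" using adj_in_verts[OF assms(4)] by simp
  then have sub: "subgraph ?H G"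
    using C(1) by (intro induced_imp_subgraph induced_induce) (auto simp: subgraph_def)
  have CH: "subgraph C ?H"
    using C(1) sub wf_digraph.tail_in_verts[of C] wf_digraph.head_in_verts[of C]
    by (auto simp: subgraph_def induce_subgraph_def compatible_def)
  let ?r = "arcs_ends (with_proj (mk_symmetric ?H))"
  have "arcs_ends C \<subseteq> arcs_ends ?H" using CH by (rule arcs_ends_mono)
  then have "conn ?r (verts C)"
    using C(2) unfolding connected_iff_conn arcs_ends_mk_symmetric
    by (elim conn_mono) auto
  moreover have "(u, w) \<in> ?r" "(w, u) \<in> ?r"
    unfolding arcs_ends_mk_symmetric arcs_ends_induce_subgraph using assms(3,4) by auto
  ultimately have "conn ?r (verts C \<union> {w})"
    using assms(3) by (intro conn_Un_edge[of ?r _ _ u w]) (auto simp: conn_singleton)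
  then have "connected ?H" unfolding connected_iff_conn by simp
  moreover have "?H \<noteq> C" using w by (metis UnI2 induce_subgraph_verts insertI1)
  ultimately show False using max CH sub by blast
qed

lemma component_invariant:
  assumes "component G C"
    and "\<And>u v. u \<rightarrow>\<^bsub>G\<^esub> v \<Longrightarrow> f u = f v" "u \<in> verts C" "v \<in> verts C"
  shows "f u = f v"
proof -
  have C: "subgraph C G" "connected C"
    using assms(1) unfolding component_def pre_digraph.max_subgraph_def by auto
  have "arcs_ends C \<subseteq> arcs_ends G" using C(1) by (rule arcs_ends_mono)
  then have e: "f x = f y" if "(x, y) \<in> arcs_ends C \<union> (arcs_ends C)\<inverse>" for x y
    using assms(2) that by (metis Un_iff converseD subsetD)
  have "(u, v) \<in> rtrancl_on (verts C) (arcs_ends C \<union> (arcs_ends C)\<inverse>)"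
    using C(2) assms(3,4) unfolding connected_iff_conn conn_def arcs_ends_mk_symmetric by blast
  then show ?thesis by induction (use e in auto)
qed

lemma rooted_relation_graph:
  assumes "graph G"
  shows "rooted_relation (verts G) (arcs_ends G)"
proof -
  interpret graph G by fact
  show ?thesis
  proof
    show "sym (arcs_ends G)" using sym_arcs by (simp add: symmetric_def)
    show "arcs_ends G \<subseteq> verts G \<times> verts G" by (auto simp: arcs_ends_conv)
  qed simp
qed

text \<open>The decomposed subgraph is induced by the union \<open>U\<close> of the bags. A
  component outside \<open>U\<close> is swept in a single step, and the bag of that step contains
  all its neighbours.\<close>

lemma pw_le:
  assumes "graph G" "S \<subseteq> verts G" "rooted_relation.good (verts G) (arcs_ends G) S n (verts G)"
    and "0 < n"
  shows "pw G S \<le> 2 * int n - 2"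
proof -
  interpret graph G by fact
  interpret rooted_relation "verts G" "arcs_ends G" S n
    by (rule rooted_relation_graph) fact
  obtain W :: "nat \<Rightarrow> 'a set" and l :: "'a \<Rightarrow> nat" and m U where W:
    "0 < m" "U = (\<Union>k<m. W k)" "U \<subseteq> verts G" "S \<subseteq> U"
    "\<And>k. k < m \<Longrightarrow> card (W k) \<le> 2 * n - 1"
    "\<And>u v. u \<in> U \<Longrightarrow> v \<in> U \<Longrightarrow> u \<rightarrow>\<^bsub>G\<^esub> v \<Longrightarrow> \<exists>k<m. u \<in> W k \<and> v \<in> W k"
    "\<And>v. v \<in> U \<Longrightarrow> \<exists>i j. i \<le> j \<and> {k. k < m \<and> v \<in> W k} = {i..j}"
    "\<And>v. v \<in> verts G \<Longrightarrow> l v < m"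
    "\<And>u w. u \<in> verts G - U \<Longrightarrow> u \<rightarrow>\<^bsub>G\<^esub> w \<Longrightarrow> (if w \<in> U then w \<in> W (l u) else l w = l u)"
    by (rule good_bags[OF assms(3,2)]) (rule that; assumption)
  define Ws where "Ws = map W [0..<m]"
  have set_Ws: "set Ws = W ` {..<m}" by (auto simp: Ws_def)
  have idx: "{k. k < length Ws \<and> v \<in> Ws ! k} = {k. k < m \<and> v \<in> W k}" for v
    by (auto simp: Ws_def)
  have "path_decomposition (G \<restriction> U) Ws"
    unfolding path_decomposition_def idx induce_subgraph_verts
  proof (intro conjI)
    show "Ws \<noteq> []" using W(1) by (simp add: Ws_def)
    show "\<forall>B\<in>set Ws. B \<subseteq> U" using W(2) by (auto simp: set_Ws)
    show "\<forall>v\<in>U. \<exists>i j. i \<le> j \<and> {k. k < m \<and> v \<in> W k} = {i..j}" by (intro ballI W(7))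
    show "\<forall>u v. u \<rightarrow>\<^bsub>G \<restriction> U\<^esub> v \<longrightarrow> (\<exists>B\<in>set Ws. u \<in> B \<and> v \<in> B)"
    proof (intro allI impI)
      fix u v assume "u \<rightarrow>\<^bsub>G \<restriction> U\<^esub> v"
      then have "u \<in> U" "v \<in> U" "u \<rightarrow>\<^bsub>G\<^esub> v" by (auto simp: arcs_ends_induce_subgraph)
      then obtain k where "k < m" "u \<in> W k" "v \<in> W k" using W(6) by metis
      then show "\<exists>B\<in>set Ws. u \<in> B \<and> v \<in> B" by (auto simp: set_Ws)
    qed
  qed
  moreover have "\<exists>B\<in>set Ws. neighbours G (verts C) \<subseteq> B"
    if C: "component (G \<restriction> (verts G - U)) C" for C
  proof -
    have sub: "verts C \<subseteq> verts G - U" and ne: "verts C \<noteq> {}"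
      using C unfolding component_def pre_digraph.max_subgraph_def subgraph_def connected_iff_conn conn_def
      by auto
    then obtain u0 where u0: "u0 \<in> verts C" by blast
    have "l x = l y" if "x \<rightarrow>\<^bsub>G \<restriction> (verts G - U)\<^esub> y" for x y
      using W(9)[of x y] that by (auto simp: arcs_ends_induce_subgraph)
    then have lC: "l u = l u0" if "u \<in> verts C" for u
      using component_invariant[OF C _ that u0] by blast
    have "neighbours G (verts C) \<subseteq> W (l u0)"
    proof
      fix w assume "w \<in> neighbours G (verts C)"
      then obtain u where u: "w \<notin> verts C" "u \<in> verts C" "u \<rightarrow>\<^bsub>G\<^esub> w" by (auto simp: neighbours_def)
      have "w \<in> U"
      proof (rule ccontr)
        assume "w \<notin> U"
        then have "u \<rightarrow>\<^bsub>G \<restriction> (verts G - U)\<^esub> w"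
          using u sub adj_in_verts[OF u(3)] by (auto simp: arcs_ends_induce_subgraph)
        moreover have "wf_digraph (G \<restriction> (verts G - U))" by (rule wellformed_induce_subgraph)
        ultimately show False using component_closed[OF _ C u(2)] u(1) by blast
      qed
      then show "w \<in> W (l u0)" using W(9)[of u w] u sub lC[OF u(2)] by auto
    qed
    moreover have "l u0 < m" using W(8) u0 sub by auto
    ultimately show ?thesis unfolding set_Ws by blast
  qed
  moreover have "induced_subgraph (G \<restriction> U) G" using W(3) by (rule induced_induce)
  ultimately have "rooted_path_decomposition G S Ws"
    unfolding rooted_path_decomposition_def using W(4)
    by (intro exI[of _ "G \<restriction> U"]) auto
  then have "pw G S \<le> width Ws" using pw_minimum[OF assms(1,2)] by metis
  also have "Max (card ` set Ws) \<le> 2 * n - 1"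
    using W(1,5) by (subst Max_le_iff) (auto simp: set_Ws)
  \<comment> \<open>The natural subtraction in \<open>2 * n - 1\<close> is exact because
    \<open>0 < n\<close>.\<close>
  then have "width Ws \<le> 2 * int n - 2" using assms(4) by (simp add: width_def)
  finally show ?thesis .
qed

section \<open>Forests\<close>

text \<open>The first vertex of a longest path inside \<open>W\<close> has all its neighbours on this path, and any
  neighbour beyond the second vertex closes a cycle.\<close>

lemma undirected_forest_leaf:
  assumes "undirected_forest F" "W \<subseteq> verts F" "W \<noteq> {}"
  obtains t p where "t \<in> W" "\<And>q. q \<in> W \<Longrightarrow> t \<rightarrow>\<^bsub>F\<^esub> q \<Longrightarrow> q = p"
proof -
  interpret graph F using assms(1) by (simp add: undirected_forest_def)
  define P where "P = (\<lambda>(u, p, v). apath u p v \<and> set (awalk_verts u p) \<subseteq> W)"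
  obtain w where "w \<in> W" using assms(3) by blast
  then have P0: "P (w, [], w)" using assms(2) by (auto simp: P_def apath_Nil_iff)
  have "length (fst (snd s)) < card (verts F)" if "P s" for s
    using that length_apath_less[of "fst s" "fst (snd s)" "snd (snd s)"] by (auto simp: P_def)
  then have "\<exists>s. P s \<and> (\<forall>s'. P s' \<longrightarrow> length (fst (snd s')) \<le> length (fst (snd s)))"
    using ex_has_greatest_nat[of P "(w, [], w)" "\<lambda>s. length (fst (snd s))" "card (verts F)"] P0
    by simp
  then obtain s where s: "P s" "\<And>s'. P s' \<Longrightarrow> length (fst (snd s')) \<le> length (fst (snd s))"
    by blast
  obtain u es v where "s = (u, es, v)" by (cases s)
  then have path: "apath u es v" "set (awalk_verts u es) \<subseteq> W"
    and longest: "\<And>u' es' v'. apath u' es' v' \<Longrightarrow> set (awalk_verts u' es') \<subseteq> W \<Longrightarrow>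
      length es' \<le> length es"
    using s by (auto simp: P_def)
  have awalk: "awalk u es v" "distinct (awalk_verts u es)" using path(1) by (auto simp: apath_def)
  \<comment> \<open>For empty \<open>es\<close> the term \<open>hd es\<close> is arbitrary, but then
    a neighbour of \<open>u\<close> in \<open>W\<close> would prolong the path, so there is no such
    \<open>q\<close>.\<close>
  have "q = head F (hd es)" if q: "q \<in> W" "u \<rightarrow>\<^bsub>F\<^esub> q" for q
  proof (rule ccontr)
    assume neq: "q \<noteq> head F (hd es)"
    have "q \<rightarrow>\<^bsub>F\<^esub> u" using q(2) sym_arcs by (rule arcs_ends_symmetric[rotated])
    then obtain e where e: "e \<in> arcs F" "tail F e = q" "head F e = u" by blast
    have "q \<in> set (awalk_verts u es)"
    proof (rule ccontr)
      assume "q \<notin> set (awalk_verts u es)"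
      then have "apath q (e # es) v" using path(1) e by (auto simp: apath_Cons_iff)
      moreover have "set (awalk_verts q (e # es)) \<subseteq> W" using path(2) q(1) e by auto
      ultimately show False using longest by fastforce
    qed
    then obtain es1 es2 where es: "es = es1 @ es2" "awalk u es1 q"
      using awalk_decomp[OF awalk(1)] by blast
    have "distinct (awalk_verts u es1)"
      using awalk es awalk_verts_append[of u es1 es2 v] by (auto simp: distinct_append)
    then have "cycle (e # es1)"
      using es(2) e adj_in_verts[OF q(2)] unfolding cycle_def
      by (intro exI[of _ q]) (auto simp: awalk_Cons_iff)
    moreover have "3 \<le> length (e # es1)"
    proof -
      have "q \<noteq> u" using q(2) adj_not_same by blast
      then have "es1 \<noteq> []" using es(2) by (auto simp: awalk_Nil_iff)
      then obtain e1 es1' where es1: "es1 = e1 # es1'" by (cases es1) auto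
      \<comment> \<open>A segment of a single arc would end in \<open>head F (hd es)\<close>, which
        differs from \<open>q\<close>.\<close>
      have "es1' \<noteq> []" using neq es es1 by (auto simp: awalk_Cons_iff awalk_Nil_iff)
      then show ?thesis using es1 by (cases es1') auto
    qed
    ultimately show False using assms(1) by (auto simp: undirected_forest_def)
  qed
  moreover have "u \<in> W" using path(2) hd_in_awalk_verts(2)[OF path(1)] by auto
  ultimately show thesis using that by blast
qed

text \<open>A vertex with at most one neighbour in \<open>W\<close> is peeled off and placed last,
  after an order of the rest.\<close>

lemma undirected_forest_degenerate_order:
  assumes "undirected_forest F" "W \<subseteq> verts F"
  shows "degenerate_order (arcs_ends F) W"
proof -
  interpret graph F using assms(1) by (simp add: undirected_forest_def)
  have "finite W" using assms(2) by (auto intro: finite_subset)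
  then show ?thesis using assms(2)
  proof (induction "card W" arbitrary: W rule: less_induct)
    case less
    show ?case
    proof (cases "W = {}")
      case False
      then obtain t p where t: "t \<in> W" "\<And>q. q \<in> W \<Longrightarrow> t \<rightarrow>\<^bsub>F\<^esub> q \<Longrightarrow> q = p"
        using undirected_forest_leaf[OF assms(1) less.prems(2)] by metis
      have "degenerate_order (arcs_ends F) (W - {t})"
        using less.prems t(1) by (intro less.hyps card_Diff1_less) auto
      then have "degenerate_order (arcs_ends F) (insert t (W - {t}))"
        by (rule degenerate_order.insert[where p = p]) (use t in auto)
      then show ?thesis using t(1) by (simp add: insert_absorb)
    qed (simp add: degenerate_order.empty)
  qed
qed

theorem theorem3p2:
  fixes F :: "('f, 'e) pre_digraph"
    and G :: "('a, 'b) pre_digraph"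
    and S :: "'a set"
  assumes "undirected_forest F" and "verts F \<noteq> {}"
    and "graph G" and "S \<subseteq> verts G"
    and "\<not> (\<exists>B. rooted_model S F G B)"
  shows "pw G S \<le> 2 * int (card (verts F)) - 2"
proof -
  interpret F: graph F using assms(1) by (simp add: undirected_forest_def)
  interpret G: graph G by fact
  interpret rooted_relation "verts G" "arcs_ends G" S "card (verts F)"
    by (rule rooted_relation_graph) fact
  have pos: "0 < card (verts F)" using assms(2) by (simp add: card_gt_0_iff)
  have "good (verts G)"
  proof (rule ccontr)
    assume bad: "\<not> good (verts G)"
    have sym: "sym (arcs_ends F)" using F.sym_arcs by (simp add: symmetric_def)
    have irrefl: "irrefl (arcs_ends F)" using F.adj_not_same by (auto simp: irrefl_def)
    obtain B where B: "partial_model (arcs_ends F) (verts F) B"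
      "\<And>i. i \<in> verts F \<Longrightarrow> B i \<inter> S \<noteq> {}"
      by (rule rooted_partial_model[OF undirected_forest_degenerate_order[OF assms(1) order_refl]
          refl pos bad sym irrefl]) (rule that; assumption)
    have "model F G B"
      unfolding model_def
    proof (intro conjI ballI allI impI)
      show "disjoint_family_on B (verts F)" using B(1) by (simp add: partial_model_def)
      show "\<exists>u\<in>B x. \<exists>v\<in>B y. u \<rightarrow>\<^bsub>G\<^esub> v" if "x \<rightarrow>\<^bsub>F\<^esub> y" for x y
        using B(1) that F.adj_in_verts[OF that] by (simp add: partial_model_def)
      fix x assume "x \<in> verts F"
      then have x: "conn (arcs_ends G) (B x)" "B x \<subseteq> verts G"
        using B(1) by (auto simp: partial_model_def)
      then show "B x \<subseteq> verts G" "B x \<noteq> {}" by (auto simp: conn_def)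
      show "connected (G \<restriction> B x)" using x(1) by (rule conn_imp_connected)
    qed
    then show False using B(2) assms(5) by (auto simp: rooted_model_def)
  qed
  then show ?thesis by (rule pw_le[OF assms(3,4) _ pos])
qed

end
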